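(* Let $z,z'\in\mathbb C$ with $z^2\ne-1$, $z'^2\neq-1$, $zz'\neq 1$, and put $z''=\dfrac{z-z'}{1-zz'}$. Then: (1) $\hat R_{12}(z'')\,\hat R_{23}(z)\,\hat R_{12}(z')=\hat R_{23}(z')\,\hat R_{12}(z)\,\hat R_{23}(z'')$ on $\mathbb C^2\otimes\mathbb C^2\otimes\mathbb C^2$. (2) Let $L^{\pm}=(L^{\pm}_{ij})_{i,j=1,2}$ be $2\times2$ matrices over a unital associative $\mathbb C$-algebra $\mathcal A$ satisfying $$R^{+}L^{+}_1L^{+}_2=L^{+}_2L^{+}_1R^{+},\qquad R^{+}L^{-}_1L^{-}_2=L^{-}_2L^{-}_1R^{+},\qquad R^{+}L^{+}_1L^{-}_2=L^{-}_2L^{+}_1R^{+},$$ and put $L(w)=\dfrac{(1+w)L^{+}+(1-w)L^{-}}{(2(1+w^2))^{1/2}}$ for $w^2\neq -1$ (so that $L(\pm1)=L^{\pm}$). Then $$\hat R(z'')\,L_2(z)\,L_1(z')=L_2(z')\,L_1(z)\,\hat R(z'').$$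
   Context: Let $P$ be the flip matrix on $\mathbb C^2\otimes\mathbb C^2$, with basis ordered $e_1\otimes e_1, e_1\otimes e_2, e_2\otimes e_1, e_2\otimes e_2$. Let $$R=\frac1{\sqrt2}\begin{pmatrix}1&0&0&1\\0&1&1&0\\0&1&-1&0\\-1&0&0&1\end{pmatrix},\qquad R^{+}=PRP,\qquad \hat R=PR,$$ $$\hat R(z)=\frac{(1+z)\hat R+(1-z)\hat R^{-1}}{(2(1+z^2))^{1/2}}=\frac1{\sqrt{1+z^2}}\begin{pmatrix}1&0&0&z\\0&1&-z&0\\0&z&1&0\\-z&0&0&1\end{pmatrix}.$$ $\hat R_{12}(z)=\hat R(z)\otimes\mathbf 1_2$ and $\hat R_{23}(z)=\mathbf 1_2\otimes\hat R(z)$. For a $2\times2$ matrix $L$ over $\mathcal A$, $L_1=L\otimes \mathbf 1$ and $L_2=\mathbf 1\otimes L$ are the $4\times4$ matrices over $\mathcal A$ with $(L_1)_{(i,k),(j,l)}=L_{ij}\delta_{kl}$ and $(L_2)_{(i,k),(j,l)}=\delta_{ij}L_{kl}$. For each parameter value a fixed choice of the square root $\sqrt{1+z^2}$ is made. Note that $z''^2\ne-1$ under the stated assumptions. *)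

theory Defs
  imports "HOL-Analysis.Analysis"
begin

text \<open>
  Index types: \<open>2\<close> has the elements \<open>1\<close> and \<open>2\<close> (with \<open>2 = 0\<close>), standing for \<open>e\<^sub>1\<close> and \<open>e\<^sub>2\<close>;
  \<open>(i, k)\<close> stands for \<open>e\<^sub>i \<otimes> e\<^sub>k\<close> and \<open>(i, k, m)\<close> for \<open>e\<^sub>i \<otimes> e\<^sub>k \<otimes> e\<^sub>m\<close>.
\<close>

text \<open>Position in the ordered basis \<open>e\<^sub>1 \<otimes> e\<^sub>1, e\<^sub>1 \<otimes> e\<^sub>2, e\<^sub>2 \<otimes> e\<^sub>1, e\<^sub>2 \<otimes> e\<^sub>2\<close>, counted from 0.\<close>

definition basis_pos :: "2 \<times> 2 \<Rightarrow> nat" where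
  "basis_pos a = (if fst a = 1 then 0 else 2) + (if snd a = 1 then 0 else 1)"

definition mat4_of_rows :: "'a list list \<Rightarrow> 'a^(2 \<times> 2)^(2 \<times> 2)" where
  "mat4_of_rows rs = (\<chi> a b. rs ! basis_pos a ! basis_pos b)"

definition flipP :: "complex^(2 \<times> 2)^(2 \<times> 2)" where
  "flipP = (\<chi> a b. if fst a = snd b \<and> snd a = fst b then 1 else 0)"

definition Rmat :: "complex^(2 \<times> 2)^(2 \<times> 2)" where
  "Rmat = (1 / sqrt 2) *\<^sub>R mat4_of_rows
     [[ 1, 0,  0, 1],
      [ 0, 1,  1, 0],
      [ 0, 1, -1, 0],
      [-1, 0,  0, 1]]"

definition Rplus :: "complex^(2 \<times> 2)^(2 \<times> 2)" where
  "Rplus = flipP ** Rmat ** flipP"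

definition Rhat :: "complex^(2 \<times> 2)^(2 \<times> 2)" where
  "Rhat = flipP ** Rmat"

text \<open>
  Throughout, \<open>s\<close> is a choice of square roots, \<open>(s w)\<^sup>2 = 1 + w\<^sup>2\<close>, and
  \<open>(2 (1 + w\<^sup>2))\<^sup>1\<^sup>/\<^sup>2\<close> is read as \<open>\<surd>2 \<cdot> s w\<close>.
\<close>

definition Rhat_param :: "(complex \<Rightarrow> complex) \<Rightarrow> complex \<Rightarrow> complex^(2 \<times> 2)^(2 \<times> 2)" where
  "Rhat_param s z = map_matrix (\<lambda>x. x / (complex_of_real (sqrt 2) * s z))
     (map_matrix ((*) (1 + z)) Rhat + map_matrix ((*) (1 - z)) (matrix_inv Rhat))"

definition on12 :: "'a::zero^(2 \<times> 2)^(2 \<times> 2) \<Rightarrow> 'a^(2 \<times> 2 \<times> 2)^(2 \<times> 2 \<times> 2)" where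
  "on12 A = (\<chi> a b. case (a, b) of ((i, k, m), (j, l, n)) \<Rightarrow>
     if m = n then A $ (i, k) $ (j, l) else 0)"

definition on23 :: "'a::zero^(2 \<times> 2)^(2 \<times> 2) \<Rightarrow> 'a^(2 \<times> 2 \<times> 2)^(2 \<times> 2 \<times> 2)" where
  "on23 A = (\<chi> a b. case (a, b) of ((i, k, m), (j, l, n)) \<Rightarrow>
     if i = j then A $ (k, m) $ (l, n) else 0)"

definition leg1 :: "'a::zero^2^2 \<Rightarrow> 'a^(2 \<times> 2)^(2 \<times> 2)" where
  "leg1 L = (\<chi> a b. case (a, b) of ((i, k), (j, l)) \<Rightarrow> if k = l then L $ i $ j else 0)"

definition leg2 :: "'a::zero^2^2 \<Rightarrow> 'a^(2 \<times> 2)^(2 \<times> 2)" where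
  "leg2 L = (\<chi> a b. case (a, b) of ((i, k), (j, l)) \<Rightarrow> if i = j then L $ k $ l else 0)"

text \<open>Unital associative algebras over the complex numbers; the zero algebra is allowed.\<close>

locale complex_algebra = vector_space scl
  for scl :: "complex \<Rightarrow> 'a::{ring, monoid_mult} \<Rightarrow> 'a" +
  assumes scale_mult_left: "scl c x * y = scl c (x * y)"
    and scale_mult_right: "x * scl c y = scl c (x * y)"

text \<open>
  The library product \<open>(**)\<close> is restricted to coefficients with \<open>0 \<noteq> 1\<close>, which would exclude
  the zero algebra; on such coefficients it agrees with the following one.
\<close>

definition amult :: "'a::semiring_0^'n^'m \<Rightarrow> 'a^'p^'n \<Rightarrow> 'a^'p^'m"  (infixl \<open>\<odot>\<close> 70) where
  "A \<odot> B = (\<chi> i j. \<Sum>k\<in>UNIV. A $ i $ k * B $ k $ j)"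

lemma amult_eq_matrix_mult: "A \<odot> B = A ** B"
  by (simp add: amult_def matrix_matrix_mult_def)

text \<open>A complex matrix regarded as a matrix over the algebra.\<close>

definition scalar_mat :: "(complex \<Rightarrow> 'a::monoid_mult \<Rightarrow> 'a) \<Rightarrow> complex^'n^'m \<Rightarrow> 'a^'n^'m" where
  "scalar_mat scl M = map_matrix (\<lambda>c. scl c 1) M"

definition L_param ::
  "(complex \<Rightarrow> 'a::ring \<Rightarrow> 'a) \<Rightarrow> (complex \<Rightarrow> complex) \<Rightarrow> 'a^2^2 \<Rightarrow> 'a^2^2 \<Rightarrow> complex \<Rightarrow> 'a^2^2" where
  "L_param scl s Lp Lm w = map_matrix (scl (1 / (complex_of_real (sqrt 2) * s w)))
     (map_matrix (scl (1 + w)) Lp + map_matrix (scl (1 - w)) Lm)"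

lemma UNIV_2_pairs: "(UNIV :: (2 \<times> 2) set) = {(1, 1), (1, 2), (2, 1), (2, 2)}"
  unfolding UNIV_Times_UNIV [symmetric] UNIV_2 by auto

lemma sum_2_pairs:
  "(\<Sum>a \<in> (UNIV :: (2 \<times> 2) set). f a) = f (1, 1) + f (1, 2) + f (2, 1) + f (2, 2)"
  for f :: "2 \<times> 2 \<Rightarrow> 'a::comm_monoid_add"
  by (simp add: UNIV_2_pairs add.assoc)

lemma Rhat_eq:
  "Rhat = (1 / sqrt 2) *\<^sub>R mat4_of_rows
     [[ 1, 0,  0, 1],
      [ 0, 1, -1, 0],
      [ 0, 1,  1, 0],
      [-1, 0,  0, 1]]"
  by (simp add: Rhat_def flipP_def Rmat_def vec_eq_iff forall_2 matrix_matrix_mult_def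
      sum_2_pairs mat4_of_rows_def basis_pos_def)

lemma matrix_inv_Rhat:
  "matrix_inv Rhat = (1 / sqrt 2) *\<^sub>R mat4_of_rows
     [[ 1,  0, 0, -1],
      [ 0,  1, 1,  0],
      [ 0, -1, 1,  0],
      [ 1,  0, 0,  1]]" (is "_ = ?B")
proof -
  have h: "(1 / complex_of_real (sqrt 2)) * (1 / complex_of_real (sqrt 2)) = 1 / 2"
    by (simp flip: of_real_mult)
  have 1: "Rhat ** ?B = mat 1"
    unfolding Rhat_eq
    by (simp add: vec_eq_iff forall_2 matrix_matrix_mult_def mat_def
      sum_2_pairs mat4_of_rows_def basis_pos_def scaleR_conv_of_real[where 'a = complex] h[simplified])
  then have 2: "?B ** Rhat = mat 1"
    by (simp add: matrix_left_right_inverse)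
  have "\<exists>A. Rhat ** A = mat 1 \<and> A ** Rhat = mat 1" using 1 2 by blast
  then have "matrix_inv Rhat ** Rhat = mat 1" unfolding matrix_inv_def by (rule someI2_ex) simp
  then have "matrix_inv Rhat ** (Rhat ** ?B) = ?B"
    by (simp only: matrix_mul_assoc matrix_mul_lid)
  then show ?thesis
    unfolding 1 matrix_mul_rid .
qed

lemma Rhat_param_eq:
  "Rhat_param s z = map_matrix (\<lambda>x. x / s z) (mat4_of_rows
     [[ 1, 0,  0, z],
      [ 0, 1, -z, 0],
      [ 0, z,  1, 0],
      [-z, 0,  0, 1]])"
proof -
  have h: "complex_of_real (sqrt 2) * complex_of_real (sqrt 2) = 2"
    by (simp flip: of_real_mult)
  show ?thesis
    unfolding Rhat_param_def matrix_inv_Rhat unfolding Rhat_eq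
    by (cases "s z = 0")
      (simp_all add: vec_eq_iff forall_2 map_matrix_def mat4_of_rows_def basis_pos_def
        scaleR_conv_of_real[where 'a = complex] field_simps h)
qed

lemma (in complex_algebra) L_param_normalised:
  assumes "s 1 = complex_of_real (sqrt 2)" "s (- 1) = complex_of_real (sqrt 2)"
  shows "L_param scl s Lp Lm 1 = Lp" "L_param scl s Lp Lm (- 1) = Lm"
proof -
  have h: "complex_of_real (sqrt 2) * complex_of_real (sqrt 2) = 2"
    by (simp flip: of_real_mult)
  show "L_param scl s Lp Lm 1 = Lp" "L_param scl s Lp Lm (- 1) = Lm"
    by (simp_all add: L_param_def assms h vec_eq_iff map_matrix_def)
qed

end

(*
  Rhat_param s z is a multiple of 1 + z K with K^2 = -1, and K_12, K_23 anticommute; expanding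
  (1) leaves only z'' + z' = z + z z' z''.

  For (2), since R^+ = Rhat P, moving the flip through turns the hypotheses into
  (1 + K) X_ab = X_ba (1 + K) with X_ab = L^a_2 L^b_1, for (a, b) = (+,+), (-,-), (+,-); the case
  (-,+), with 1 - K in place of 1 + K, follows by multiplying with (1 + K)^(-1) on both sides.
  With u = (1 + z)(1 - z') and v = (1 - z)(1 + z') one has z'' = (u - v) / (u + v), and comparing
  the coefficients of X_(+-) and X_(-+) proves the relation.
*)

theory Submission
  imports Defs
begin

section \<open>Ring laws for matrices over a possibly noncommutative, possibly zero ring\<close>

lemma amult_nth: "(A \<odot> B) $ i $ j = (\<Sum>k\<in>UNIV. A $ i $ k * B $ k $ j)"
  by (simp add: amult_def)

lemma amult_assoc: "(A \<odot> B) \<odot> C = A \<odot> (B \<odot> C)"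
proof -
  have "(\<Sum>k\<in>UNIV. (\<Sum>l\<in>UNIV. A $ i $ l * B $ l $ k) * C $ k $ j)
      = (\<Sum>l\<in>UNIV. A $ i $ l * (\<Sum>k\<in>UNIV. B $ l $ k * C $ k $ j))" for i j
    unfolding sum_distrib_left sum_distrib_right mult.assoc by (rule sum.swap)
  then show ?thesis
    by (simp add: vec_eq_iff amult_nth)
qed

lemma amult_add_left: "(A + B) \<odot> C = A \<odot> C + B \<odot> C"
  by (simp add: vec_eq_iff amult_nth distrib_right sum.distrib)

lemma amult_add_right: "A \<odot> (B + C) = A \<odot> B + A \<odot> C"
  by (simp add: vec_eq_iff amult_nth distrib_left sum.distrib)

lemma amult_uminus_left: "(- A) \<odot> B = - (A \<odot> B)" for A :: "'a::ring^'n^'m"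
  by (simp add: vec_eq_iff amult_nth sum_negf)

lemma amult_uminus_right: "A \<odot> (- B) = - (A \<odot> B)" for A :: "'a::ring^'n^'m"
  by (simp add: vec_eq_iff amult_nth sum_negf)

lemma amult_diff_left: "(A - B) \<odot> C = A \<odot> C - B \<odot> C" for A :: "'a::ring^'n^'m"
  by (simp add: vec_eq_iff amult_nth left_diff_distrib sum_subtractf)

lemma amult_diff_right: "A \<odot> (B - C) = A \<odot> B - A \<odot> C" for A :: "'a::ring^'n^'m"
  by (simp add: vec_eq_iff amult_nth right_diff_distrib sum_subtractf)

lemma mat_one_amult: "mat 1 \<odot> A = A" for A :: "'a::{ring, monoid_mult}^'n^'m"
  by (simp add: vec_eq_iff amult_nth mat_def if_distrib if_distribR cong: if_cong)

lemma amult_mat_one: "A \<odot> mat 1 = A" for A :: "'a::{ring, monoid_mult}^'n^'m"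
  by (simp add: vec_eq_iff amult_nth mat_def if_distrib if_distribR cong: if_cong)

lemmas amult_simps = amult_assoc amult_add_left amult_add_right amult_diff_left amult_diff_right
  amult_uminus_left amult_uminus_right mat_one_amult amult_mat_one

text \<open>\<open>\<sigma>\<^sub>x \<otimes> i\<sigma>\<^sub>y\<close>, the generator with square \<open>-1\<close> such that \<open>Rhat_param s z = (1 + z K) / s z\<close>.\<close>

definition Kmat :: "complex^(2 \<times> 2)^(2 \<times> 2)" where
  "Kmat = mat4_of_rows
     [[ 0, 0,  0, 1],
      [ 0, 0, -1, 0],
      [ 0, 1,  0, 0],
      [-1, 0,  0, 0]]"

section \<open>Scalar action on matrices and the two abstract spectral identities\<close>

context complex_algebra
begin

definition smul :: "complex \<Rightarrow> 'a^'n^'m \<Rightarrow> 'a^'n^'m" where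
  "smul c A = map_matrix (scl c) A"

lemma smul_nth: "smul c A $ i $ j = scl c (A $ i $ j)"
  by (simp add: smul_def map_matrix_def)

lemma vector_space_smul: "vector_space (smul :: complex \<Rightarrow> 'a^'n^'m \<Rightarrow> 'a^'n^'m)"
  by unfold_locales
    (simp_all add: vec_eq_iff smul_nth scale_right_distrib scale_left_distrib)

interpretation M: vector_space "smul :: complex \<Rightarrow> 'a^'n^'m \<Rightarrow> 'a^'n^'m"
  by (rule vector_space_smul)

lemma smul_amult: "smul c A \<odot> B = smul c (A \<odot> B)"
  by (simp add: vec_eq_iff amult_nth smul_nth scale_mult_left scale_sum_right)

lemma amult_smul: "A \<odot> smul c B = smul c (A \<odot> B)"
  by (simp add: vec_eq_iff amult_nth smul_nth scale_mult_right scale_sum_right)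

lemma scalar_mat_nth: "scalar_mat scl A $ i $ j = scl (A $ i $ j) 1"
  by (simp add: scalar_mat_def map_matrix_def)

text \<open>Multiplicativity carries the relations \<open>K^2 = -1\<close> and
  \<open>P^2 = 1\<close> from complex matrices to matrices over the algebra.\<close>

lemma scalar_mat_mult: "scalar_mat scl (A ** B) = scalar_mat scl A \<odot> scalar_mat scl B"
  by (simp add: vec_eq_iff amult_nth scalar_mat_nth matrix_matrix_mult_def scale_sum_left
      scale_mult_left)

lemma scalar_mat_mat_one: "scalar_mat scl (mat 1) = mat 1"
  by (simp add: vec_eq_iff scalar_mat_nth mat_def)

lemma scalar_mat_uminus: "scalar_mat scl (- A) = - scalar_mat scl A"
  by (simp add: vec_eq_iff scalar_mat_nth)

text \<open>The constant and quadratic terms of the two sides agree after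
  \<open>a b = - b a\<close>, and the cubic terms collapse to multiples of \<open>b\<close> and
  \<open>a\<close>. What remains are the coefficients of \<open>a\<close> and of \<open>b\<close>,
  and both comparisons are the equation \<open>z\<close>.\<close>

lemma yang_baxter_anticommuting:
  fixes a b :: "'a^'n^'n"
  assumes aa: "a \<odot> a = - mat 1" and bb: "b \<odot> b = - mat 1" and ab: "a \<odot> b = - (b \<odot> a)"
    and z: "y + x = z + z * x * y"
  shows "(mat 1 + smul y a) \<odot> (mat 1 + smul z b) \<odot> (mat 1 + smul x a)
       = (mat 1 + smul x b) \<odot> (mat 1 + smul z a) \<odot> (mat 1 + smul y b)"
proof -
  \<comment> \<open>Anticommuting once gives \<open>a b a = - b a a\<close>, and
    \<open>a a = -1\<close>.\<close>
  have aba: "a \<odot> (b \<odot> a) = b"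
    by (metis aa ab add.inverse_inverse amult_assoc amult_uminus_left amult_uminus_right
        amult_mat_one mat_one_amult)
  have bab: "b \<odot> (a \<odot> b) = a"
    by (metis bb ab add.inverse_inverse amult_assoc amult_uminus_left amult_uminus_right
        amult_mat_one mat_one_amult)
  have ya: "smul y a + smul x a = smul z a + smul (z * x * y) a"
    and yb: "smul y b + smul x b = smul z b + smul (z * x * y) b"
    by (simp_all only: z flip: M.scale_left_distrib)
  have "(mat 1 + smul y a) \<odot> (mat 1 + smul z b) \<odot> (mat 1 + smul x a)
     = mat 1 - smul (x * y) (mat 1) + (smul y a + smul x a) + (smul z b + smul (z * x * y) b)
       + smul (z * x) (b \<odot> a) - smul (y * z) (b \<odot> a)"
    by (simp add: amult_simps smul_amult amult_smul aa ab aba M.scale_right_distrib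
        M.scale_right_diff_distrib mult_ac)
  moreover have "(mat 1 + smul x b) \<odot> (mat 1 + smul z a) \<odot> (mat 1 + smul y b)
     = mat 1 - smul (x * y) (mat 1) + (smul z a + smul (z * x * y) a) + (smul y b + smul x b)
       + smul (z * x) (b \<odot> a) - smul (y * z) (b \<odot> a)"
    \<comment> \<open>The rule \<open>ab\<close> turns the cubic term into \<open>- b (b a)\<close>,
      so \<open>bab\<close> is supplied in that rewritten form.\<close>
    by (simp add: amult_simps smul_amult amult_smul bb ab
        bab[unfolded ab amult_uminus_right] M.scale_right_distrib M.scale_right_diff_distrib mult_ac)
  ultimately show ?thesis
    by (simp only: ya yb)
qed

text \<open>Here \<open>a, a'\<close> stand for the second and first legs of \<open>L^+\<close>, and
  \<open>b, b'\<close> for those of \<open>L^-\<close>. The pure products \<open>p\<close>,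
  \<open>q\<close> commute with \<open>k\<close> and have the same coefficients on both sides; the
  mixed products \<open>v\<close>, \<open>w\<close> have their coefficients \<alpha>, \<beta>
  exchanged.\<close>

lemma rll_spectral:
  fixes k a a' b b' :: "'a^'n^'n"
  assumes kk: "k \<odot> k = - mat 1"
    and pp: "(mat 1 + k) \<odot> (a \<odot> a') = (a \<odot> a') \<odot> (mat 1 + k)"
    and mm: "(mat 1 + k) \<odot> (b \<odot> b') = (b \<odot> b') \<odot> (mat 1 + k)"
    and pm: "(mat 1 + k) \<odot> (a \<odot> b') = (b \<odot> a') \<odot> (mat 1 + k)"
    and y: "y * (1 - z * x) = z - x"
  shows "(mat 1 + smul y k) \<odot> (smul (1 + z) a + smul (1 - z) b) \<odot> (smul (1 + x) a' + smul (1 - x) b')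
       = (smul (1 + x) a + smul (1 - x) b) \<odot> (smul (1 + z) a' + smul (1 - z) b') \<odot> (mat 1 + smul y k)"
proof -
  define p where "p = a \<odot> a'"
  define q where "q = b \<odot> b'"
  define v where "v = a \<odot> b'"
  define w where "w = b \<odot> a'"
  define \<alpha> where "\<alpha> = (1 + z) * (1 - x)"
  define \<beta> where "\<beta> = (1 - z) * (1 + x)"
  have kp: "k \<odot> p = p \<odot> k" and kq: "k \<odot> q = q \<odot> k"
    using pp mm by (simp_all add: p_def q_def amult_simps)
  have vw: "v + k \<odot> v = w + w \<odot> k"
    using pm by (simp add: v_def w_def amult_simps)
  \<comment> \<open>This and \<open>vk\<close> below bring \<open>k\<close> to the left of the mixed
    products. The terms in \<open>k v\<close> and \<open>k w\<close> then cancel, leaving a multiple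
    of \<open>v - w\<close>.\<close>
  have wk: "w \<odot> k = v + k \<odot> v - w"
    using vw by simp
  \<comment> \<open>The relation for \<open>(L\<^sup>-, L\<^sup>+)\<close> is \<open>vw\<close> multiplied on both sides by \<open>(1 + k)\<inverse> = (1 - k) / 2\<close>.\<close>
  have "(mat 1 - k) \<odot> (v + k \<odot> v) \<odot> (mat 1 - k) = (mat 1 - k) \<odot> (w + w \<odot> k) \<odot> (mat 1 - k)"
    by (simp only: vw)
  moreover have "(mat 1 - k) \<odot> (v + k \<odot> v) = v + v"
    by (simp add: amult_simps) (simp add: kk amult_uminus_left mat_one_amult flip: amult_assoc)
  moreover have "(w + w \<odot> k) \<odot> (mat 1 - k) = w + w"
    by (simp add: kk amult_simps)
  ultimately have "(v + v) \<odot> (mat 1 - k) = (mat 1 - k) \<odot> (w + w)"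
    by (simp add: amult_assoc)
  then have "v - v \<odot> k + (v - v \<odot> k) = w - k \<odot> w + (w - k \<odot> w)"
    by (simp add: amult_simps algebra_simps)
  \<comment> \<open>The doubled equation is halved through the complex scalar action.\<close>
  then have "smul (1/2) (v - v \<odot> k + (v - v \<odot> k)) = smul (1/2) (w - k \<odot> w + (w - k \<odot> w))"
    by (simp only:)
  then have "v - v \<odot> k = w - k \<odot> w"
    by (simp only: M.scale_right_distrib flip: M.scale_left_distrib) simp
  then have vk: "v \<odot> k = v - w + k \<odot> w"
    by (simp add: algebra_simps)
  \<comment> \<open>Indeed \<alpha> + \<beta> = 2 (1 - z x) and \<alpha> - \<beta> = 2 (z -
    x).\<close>
  have y': "y * \<alpha> + y * \<beta> = \<alpha> - \<beta>"
    using y unfolding \<alpha>_def \<beta>_def by algebra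
  have ab: "smul (y * \<alpha>) u + smul (y * \<beta>) u = smul \<alpha> u - smul \<beta> u" for u :: "'a^'n^'n"
    by (simp only: y' flip: M.scale_left_distrib M.scale_left_diff_distrib)
  have "(smul (1 + z) a + smul (1 - z) b) \<odot> (smul (1 + x) a' + smul (1 - x) b')
      = smul ((1 + z) * (1 + x)) p + smul ((1 - z) * (1 - x)) q + smul \<alpha> v + smul \<beta> w"
    by (simp add: amult_add_left amult_add_right smul_amult amult_smul
        p_def q_def v_def w_def \<alpha>_def \<beta>_def M.scale_right_distrib mult_ac)
  moreover have "(smul (1 + x) a + smul (1 - x) b) \<odot> (smul (1 + z) a' + smul (1 - z) b')
      = smul ((1 + z) * (1 + x)) p + smul ((1 - z) * (1 - x)) q + smul \<beta> v + smul \<alpha> w"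
    by (simp add: amult_add_left amult_add_right smul_amult amult_smul
        p_def q_def v_def w_def \<alpha>_def \<beta>_def M.scale_right_distrib mult_ac)
  moreover have "(mat 1 + smul y k) \<odot> (smul c p + smul d q + smul \<alpha> v + smul \<beta> w)
      = (smul c p + smul d q + smul \<beta> v + smul \<alpha> w) \<odot> (mat 1 + smul y k)" for c d
    using ab[of v] ab[of w]
    by (simp add: amult_add_left amult_add_right mat_one_amult amult_mat_one smul_amult amult_smul
        kp kq wk vk M.scale_right_distrib M.scale_right_diff_distrib mult_ac algebra_simps)
  ultimately show ?thesis
    by (simp add: amult_assoc)
qed

section \<open>Linearity of the legs and their exchange by the flip\<close>

lemma leg1_add: "leg1 (A + B) = leg1 A + leg1 B" for A B :: "'a^2^2"
  by (simp add: vec_eq_iff leg1_def split: prod.split)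

lemma leg2_add: "leg2 (A + B) = leg2 A + leg2 B" for A B :: "'a^2^2"
  by (simp add: vec_eq_iff leg2_def split: prod.split)

lemma leg1_smul: "leg1 (smul c A) = smul c (leg1 A)"
  by (simp add: vec_eq_iff leg1_def smul_nth split: prod.split)

lemma leg2_smul: "leg2 (smul c A) = smul c (leg2 A)"
  by (simp add: vec_eq_iff leg2_def smul_nth split: prod.split)

lemma flip_leg1: "scalar_mat scl flipP \<odot> leg1 A = leg2 A \<odot> scalar_mat scl flipP"
  by (simp add: vec_eq_iff forall_2 amult_nth sum_2_pairs scalar_mat_nth flipP_def leg1_def leg2_def)

lemma flip_leg2: "scalar_mat scl flipP \<odot> leg2 A = leg1 A \<odot> scalar_mat scl flipP"
  by (simp add: vec_eq_iff forall_2 amult_nth sum_2_pairs scalar_mat_nth flipP_def leg1_def leg2_def)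

text \<open>The common shape of \<open>Rhat\<close> and \<open>Rhat_param s z\<close>, as given by
  \<open>Rhat_affine\<close> and \<open>Rhat_param_affine\<close>.\<close>

lemma scalar_mat_affine:
  "scalar_mat scl (map_matrix ((*) c) (mat 1 + map_matrix ((*) z) A))
   = smul c (mat 1 + smul z (scalar_mat scl A))"
  by (simp add: vec_eq_iff scalar_mat_nth smul_nth map_matrix_def mat_def
      scale_left_distrib scale_right_distrib distrib_left)

end

section \<open>Relations among the concrete complex matrices\<close>

lemma flipP_involution: "flipP ** flipP = mat 1"
  by (simp add: vec_eq_iff forall_2 matrix_matrix_mult_def sum_2_pairs flipP_def mat_def)

lemma Kmat_square: "Kmat ** Kmat = - mat 1"
  by (simp add: vec_eq_iff forall_2 matrix_matrix_mult_def sum_2_pairs Kmat_def mat_def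
      mat4_of_rows_def basis_pos_def)

lemma Rhat_affine:
  "Rhat = map_matrix ((*) (complex_of_real (1 / sqrt 2))) (mat 1 + map_matrix ((*) 1) Kmat)"
  by (simp add: Rhat_eq vec_eq_iff forall_2 Kmat_def mat_def mat4_of_rows_def basis_pos_def
      map_matrix_def scaleR_conv_of_real[where 'a = complex])

lemma Rhat_param_affine:
  "Rhat_param s z = map_matrix ((*) (1 / s z)) (mat 1 + map_matrix ((*) z) Kmat)"
  by (simp add: Rhat_param_eq vec_eq_iff forall_2 Kmat_def mat_def mat4_of_rows_def basis_pos_def
      map_matrix_def)

lemma sum_2_triples:
  "(\<Sum>a \<in> (UNIV :: (2 \<times> 2 \<times> 2) set). f a)
   = (\<Sum>b \<in> UNIV. f (1, b)) + (\<Sum>b \<in> UNIV. f (2, b))"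
  for f :: "2 \<times> 2 \<times> 2 \<Rightarrow> 'a::comm_monoid_add"
proof -
  have "sum f UNIV = (\<Sum>i\<in>UNIV. \<Sum>b\<in>UNIV. f (i, b))"
    by (simp add: sum.cartesian_product UNIV_Times_UNIV)
  then show ?thesis
    by (simp add: sum_2)
qed

lemma on12_Kmat_square: "on12 Kmat ** on12 Kmat = - mat 1"
  by (simp add: vec_eq_iff forall_2 matrix_matrix_mult_def sum_2_triples sum_2_pairs on12_def
      Kmat_def mat_def mat4_of_rows_def basis_pos_def)

lemma on23_Kmat_square: "on23 Kmat ** on23 Kmat = - mat 1"
  by (simp add: vec_eq_iff forall_2 matrix_matrix_mult_def sum_2_triples sum_2_pairs on23_def
      Kmat_def mat_def mat4_of_rows_def basis_pos_def)

text \<open>\<open>K_12\<close> and \<open>K_23\<close> both act nontrivially only in the middle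
  tensor factor, by \<open>i \<sigma>_y\<close> and \<open>\<sigma>_x\<close>, which
  anticommute.\<close>

lemma on12_on23_Kmat_anticommute: "on12 Kmat ** on23 Kmat = - (on23 Kmat ** on12 Kmat)"
  by (simp add: vec_eq_iff forall_2 matrix_matrix_mult_def sum_2_triples sum_2_pairs on12_def
      on23_def Kmat_def mat4_of_rows_def basis_pos_def)

section \<open>The relations for \<open>L(w)\<close>\<close>

context complex_algebra
begin

text \<open>\<open>Rplus = P R P = Rhat P\<close> is a nonzero multiple of \<open>(1 + K) P\<close>,
  and passing \<open>P\<close> through the legs exchanges them. General \<open>A\<close>,
  \<open>B\<close> cover all three hypotheses on \<open>L^+\<close> and \<open>L^-\<close>.\<close>

lemma rll_Rhat:
  assumes "scalar_mat scl Rplus \<odot> leg1 A \<odot> leg2 B = leg2 B \<odot> leg1 A \<odot> scalar_mat scl Rplus"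
  shows "(mat 1 + scalar_mat scl Kmat) \<odot> (leg2 A \<odot> leg1 B)
       = (leg2 B \<odot> leg1 A) \<odot> (mat 1 + scalar_mat scl Kmat)"
proof -
  interpret M: vector_space "smul :: complex \<Rightarrow> 'a^(2 \<times> 2)^(2 \<times> 2) \<Rightarrow> 'a^(2 \<times> 2)^(2 \<times> 2)"
    by (rule vector_space_smul)
  let ?P = "scalar_mat scl flipP" and ?T = "mat 1 + scalar_mat scl Kmat"
  let ?c = "complex_of_real (1 / sqrt 2)"
  have PP: "?P \<odot> ?P = mat 1"
    by (simp only: flipP_involution scalar_mat_mat_one flip: scalar_mat_mult)
  have R: "scalar_mat scl Rplus = smul ?c (?T \<odot> ?P)"
    unfolding Rplus_def Rhat_def[symmetric] scalar_mat_mult Rhat_affine scalar_mat_affine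
    by (simp add: smul_amult)
  have "smul ?c (?T \<odot> ?P \<odot> leg1 A \<odot> leg2 B) = smul ?c (leg2 B \<odot> leg1 A \<odot> ?T \<odot> ?P)"
    using assms unfolding R by (simp add: smul_amult amult_smul amult_assoc)
  then have "?T \<odot> ?P \<odot> leg1 A \<odot> leg2 B = leg2 B \<odot> leg1 A \<odot> ?T \<odot> ?P"
    by (subst (asm) M.scale_left_imp_eq) auto
  \<comment> \<open>After multiplication by \<open>?P\<close> on the right, both sides end in
    \<open>?P \<odot> ?P = mat 1\<close> once the inner flip has passed through the legs.\<close>
  then have "?T \<odot> (?P \<odot> leg1 A \<odot> leg2 B) \<odot> ?P = leg2 B \<odot> leg1 A \<odot> ?T \<odot> (?P \<odot> ?P)"
    by (simp only: amult_assoc)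
  also have "?P \<odot> leg1 A \<odot> leg2 B = leg2 A \<odot> leg1 B \<odot> ?P"
    by (simp only: flip_leg1 flip_leg2 amult_assoc)
  finally show ?thesis
    by (simp only: PP amult_assoc amult_mat_one)
qed

text \<open>Instance of \<open>rll_spectral\<close> with \<open>k\<close> the image of
  \<open>Kmat\<close>. The last assumption defines \<open>z''\<close> with its denominator
  cleared.\<close>

theorem rll_baxterised:
  assumes "scalar_mat scl Rplus \<odot> leg1 Lp \<odot> leg2 Lp = leg2 Lp \<odot> leg1 Lp \<odot> scalar_mat scl Rplus"
    and "scalar_mat scl Rplus \<odot> leg1 Lm \<odot> leg2 Lm = leg2 Lm \<odot> leg1 Lm \<odot> scalar_mat scl Rplus"
    and "scalar_mat scl Rplus \<odot> leg1 Lp \<odot> leg2 Lm = leg2 Lm \<odot> leg1 Lp \<odot> scalar_mat scl Rplus"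
    and "y * (1 - z * x) = z - x"
  shows "scalar_mat scl (Rhat_param s y) \<odot> leg2 (L_param scl s Lp Lm z) \<odot> leg1 (L_param scl s Lp Lm x)
    = leg2 (L_param scl s Lp Lm x) \<odot> leg1 (L_param scl s Lp Lm z) \<odot> scalar_mat scl (Rhat_param s y)"
proof -
  interpret M: vector_space "smul :: complex \<Rightarrow> 'a^(2 \<times> 2)^(2 \<times> 2) \<Rightarrow> 'a^(2 \<times> 2)^(2 \<times> 2)"
    by (rule vector_space_smul)
  have L: "L_param scl s Lp Lm w
      = smul (1 / (complex_of_real (sqrt 2) * s w)) (smul (1 + w) Lp + smul (1 - w) Lm)" for w
    by (simp add: L_param_def smul_def)
  have kk: "scalar_mat scl Kmat \<odot> scalar_mat scl Kmat = - mat 1"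
    by (simp only: Kmat_square scalar_mat_uminus scalar_mat_mat_one flip: scalar_mat_mult)
  have "(mat 1 + smul y (scalar_mat scl Kmat)) \<odot> (smul (1 + z) (leg2 Lp) + smul (1 - z) (leg2 Lm))
        \<odot> (smul (1 + x) (leg1 Lp) + smul (1 - x) (leg1 Lm))
      = (smul (1 + x) (leg2 Lp) + smul (1 - x) (leg2 Lm)) \<odot> (smul (1 + z) (leg1 Lp) + smul (1 - z) (leg1 Lm))
        \<odot> (mat 1 + smul y (scalar_mat scl Kmat))"
    by (intro rll_spectral rll_Rhat kk assms)
  then show ?thesis
    \<comment> \<open>The normalising scalars are pulled to the front; they agree on both sides up
      to order.\<close>
    unfolding L Rhat_param_affine scalar_mat_affine leg1_smul leg2_smul leg1_add leg2_add
      smul_amult amult_smul M.scale_scale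
    by (simp add: mult_ac)
qed

end

text \<open>The complex numbers as an algebra over themselves, so that
  \<open>yang_baxter_anticommuting\<close> applies to complex matrices.\<close>

interpretation complex_mult: complex_algebra "(*) :: complex \<Rightarrow> complex \<Rightarrow> complex"
  by unfold_locales (simp_all add: algebra_simps)

lemma on12_Rhat_param:
  "on12 (Rhat_param s z) = complex_mult.smul (1 / s z) (mat 1 + complex_mult.smul z (on12 Kmat))"
  by (simp add: Rhat_param_affine vec_eq_iff on12_def complex_mult.smul_nth map_matrix_def mat_def)

lemma on23_Rhat_param:
  "on23 (Rhat_param s z) = complex_mult.smul (1 / s z) (mat 1 + complex_mult.smul z (on23 Kmat))"
  by (simp add: Rhat_param_affine vec_eq_iff on23_def complex_mult.smul_nth map_matrix_def mat_def)

theorem yang_baxter_Rhat_param: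
  assumes "y * (1 - z * x) = z - x"
  shows "on12 (Rhat_param s y) ** on23 (Rhat_param s z) ** on12 (Rhat_param s x)
       = on23 (Rhat_param s x) ** on12 (Rhat_param s z) ** on23 (Rhat_param s y)"
proof -
  have "y + x = z + z * x * y"
    using assms by (simp add: algebra_simps)
  note complex_mult.yang_baxter_anticommuting
    [OF on12_Kmat_square[folded amult_eq_matrix_mult] on23_Kmat_square[folded amult_eq_matrix_mult]
      on12_on23_Kmat_anticommute[folded amult_eq_matrix_mult] this]
  then show ?thesis
    unfolding on12_Rhat_param on23_Rhat_param amult_eq_matrix_mult[symmetric]
      complex_mult.smul_amult complex_mult.amult_smul
      vector_space.vector_space_assms(3)[OF complex_mult.vector_space_smul]
    by (simp add: mult_ac)
qed

theorem mainTheorem2: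
  fixes s :: "complex \<Rightarrow> complex" and z z' z'' :: complex
  assumes "\<forall>w. (s w)\<^sup>2 = 1 + w\<^sup>2"
    and "z\<^sup>2 \<noteq> -1" and "z'\<^sup>2 \<noteq> -1" and "z * z' \<noteq> 1"
    and "z'' = (z - z') / (1 - z * z')"
  shows "on12 (Rhat_param s z'') ** on23 (Rhat_param s z) ** on12 (Rhat_param s z')
         = on23 (Rhat_param s z') ** on12 (Rhat_param s z) ** on23 (Rhat_param s z'')
    \<and> (\<forall>(scl :: complex \<Rightarrow> 'a::{ring, monoid_mult} \<Rightarrow> 'a) (Lp :: 'a^2^2) (Lm :: 'a^2^2).
        complex_algebra scl \<longrightarrow>
        scalar_mat scl Rplus \<odot> leg1 Lp \<odot> leg2 Lp = leg2 Lp \<odot> leg1 Lp \<odot> scalar_mat scl Rplus \<longrightarrow>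
        scalar_mat scl Rplus \<odot> leg1 Lm \<odot> leg2 Lm = leg2 Lm \<odot> leg1 Lm \<odot> scalar_mat scl Rplus \<longrightarrow>
        scalar_mat scl Rplus \<odot> leg1 Lp \<odot> leg2 Lm = leg2 Lm \<odot> leg1 Lp \<odot> scalar_mat scl Rplus \<longrightarrow>
        scalar_mat scl (Rhat_param s z'') \<odot> leg2 (L_param scl s Lp Lm z) \<odot> leg1 (L_param scl s Lp Lm z')
        = leg2 (L_param scl s Lp Lm z') \<odot> leg1 (L_param scl s Lp Lm z) \<odot> scalar_mat scl (Rhat_param s z''))"
proof -
  \<comment> \<open>The denominator is nonzero because \<open>z * z' \<noteq> 1\<close>.\<close>
  have "z'' * (1 - z * z') = z - z'"
    using assms by simp
  then show ?thesis
    by (auto intro: yang_baxter_Rhat_param complex_algebra.rll_baxterised)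
qed

end
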